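(* Let $F_1\in\mathcal H[s_1],\dots,F_r\in\mathcal H[s_r]$ be homogeneous polynomial systems in $x_0,\dots,x_n$ with $s_1+\cdots+s_r\le n$, and let $G=(F_1,\dots,F_r)\in\mathcal H[s_1+\cdots+s_r]$ be the concatenation of the systems. For any $x\in\mathbb P^n$, $$\gamma(G,x)\le\hat\gamma(F_1,\dots,F_r;x)\le r\,\kappa(F_1,\dots,F_r;x)\,\gamma(G,x).$$
   Context: $\mathcal H[s]$ denotes a space of systems of $s\geq 1$ complex homogeneous polynomials in $x_0,\dots,x_n$ of prescribed positive degrees, regarded as polynomial maps $\mathbb C^{n+1}\to\mathbb C^s$ (the degrees may differ from block to block). For $x\in\mathbb P^n$, $\mathrm d_x^kF$ is the $k$th derivative at a unit-norm representative of $x$ (the quantities below do not depend on the choice). $\phi^\dagger$ is the Moore–Penrose pseudo-inverse, and norms of (multi)linear maps are operator norms. Gamma number: $\gamma(F,x)=\sup_{k\ge2}\big\|\tfrac1{k!}\mathrm d_xF^\dagger\cdot\mathrm d_x^kF\big\|^{1/(k-1)}$ if $\mathrm d_xF$ is surjective, and $\gamma(F,x)=\infty$ otherwise. Incidence condition number of subspaces $E_1,\dots,E_r$ of a Hermitian space $V$: let $\operatorname{proj}(E_1,\dots,E_r):V\to E_1\times\cdots\times E_r$, $v\mapsto(\pi_1v,\dots,\pi_rv)$, with $\pi_i$ the orthogonal projection onto $E_i$; then $\kappa(E_1,\dots,E_r)=\|\operatorname{proj}(E_1,\dots,E_r)^\dagger\|$ if this map is surjective, and $\infty$ otherwise. For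 systems, $\kappa(F_1,\dots,F_r;x)=\kappa\big((\ker\mathrm d_xF_1)^\perp,\dots,(\ker\mathrm d_xF_r)^\perp\big)$. Split gamma number: $\hat\gamma(F_1,\dots,F_r;x)=\kappa(F_1,\dots,F_r;x)\big(\gamma(F_1,x)^2+\cdots+\gamma(F_r,x)^2\big)^{1/2}$. Convention: a product one of whose factors is $\infty$ equals $\infty$. *)

theory Defs
  imports "HOL-Analysis.Analysis"
begin

section \<open>Homogeneous polynomial systems\<close>

text \<open>
  A system of \<open>s\<close> equations is a list of \<open>s\<close> polynomial functions on \<open>complex ^ 'n\<close>; with
  \<open>n + 1\<close> variables, \<open>CARD('n) = n + 1\<close>. Correspondingly, \<open>\<complex>\<^sup>s\<close> is the set of complex lists of
  length \<open>s\<close>, and concatenation of systems is \<^const>\<open>concat\<close>.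
\<close>

type_synonym 'n poly_system = "(complex ^ 'n \<Rightarrow> complex) list"

definition homogeneous_poly :: "nat \<Rightarrow> (complex ^ 'n \<Rightarrow> complex) \<Rightarrow> bool" where
  "homogeneous_poly d f \<longleftrightarrow>
     (\<exists>c :: ('n \<Rightarrow> nat) \<Rightarrow> complex. \<forall>x.
        f x = (\<Sum>m \<in> {m. (\<Sum>i\<in>UNIV. m i) = d}. c m * (\<Prod>i\<in>UNIV. (x $ i) ^ m i)))"

definition hom_systems :: "nat list \<Rightarrow> 'n::finite poly_system set" where
  "hom_systems ds = {F. ds \<noteq> [] \<and> (\<forall>d\<in>set ds. 0 < d) \<and> list_all2 homogeneous_poly ds F}"

lemma concat_in_hom_systems:
  assumes "Ds \<noteq> []" and "list_all2 (\<lambda>D F. F \<in> hom_systems D) Ds Fs"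
  shows "concat Fs \<in> hom_systems (concat Ds)"
  using assms(2,1)
proof (induction rule: list_all2_induct)
  case (Cons D Ds F Fs)
  then show ?case
    by (cases "Ds = []") (auto simp: hom_systems_def intro: list_all2_appendI)
qed simp


section \<open>Hermitian structure and the Moore--Penrose pseudo-inverse\<close>

definition cinner :: "complex ^ 'n \<Rightarrow> complex ^ 'n \<Rightarrow> complex" where
  "cinner v w = (\<Sum>i\<in>UNIV. v $ i * cnj (w $ i))"

definition list_cinner :: "('a \<Rightarrow> 'a \<Rightarrow> complex) \<Rightarrow> 'a list \<Rightarrow> 'a list \<Rightarrow> complex" where
  "list_cinner ip us ws = (\<Sum>(u, w) \<leftarrow> zip us ws. ip u w)"

definition list_norm :: "'a::real_normed_vector list \<Rightarrow> real" where
  "list_norm ws = sqrt (\<Sum>w\<leftarrow>ws. (norm w)\<^sup>2)"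

text \<open>
  The four Penrose equations for \<open>\<phi> : \<complex>\<^sup>n\<^sup>+\<^sup>1 \<rightarrow> W\<close> and \<open>\<psi> : W \<rightarrow> \<complex>\<^sup>n\<^sup>+\<^sup>1\<close>, where \<open>W\<close> carries the Hermitian
  product \<open>ip\<close>.
\<close>

definition is_pinv ::
  "('b \<Rightarrow> 'b \<Rightarrow> complex) \<Rightarrow> 'b set \<Rightarrow> (complex ^ 'n \<Rightarrow> 'b) \<Rightarrow> ('b \<Rightarrow> complex ^ 'n) \<Rightarrow> bool" where
  "is_pinv ip W \<phi> \<psi> \<longleftrightarrow>
     (\<forall>v. \<phi> (\<psi> (\<phi> v)) = \<phi> v) \<and>
     (\<forall>w\<in>W. \<psi> (\<phi> (\<psi> w)) = \<psi> w) \<and>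
     (\<forall>w\<in>W. \<forall>w'\<in>W. ip (\<phi> (\<psi> w)) w' = ip w (\<phi> (\<psi> w'))) \<and>
     (\<forall>v v'. cinner (\<psi> (\<phi> v)) v' = cinner v (\<psi> (\<phi> v')))"

definition pinv ::
  "('b \<Rightarrow> 'b \<Rightarrow> complex) \<Rightarrow> 'b set \<Rightarrow> (complex ^ 'n \<Rightarrow> 'b) \<Rightarrow> ('b \<Rightarrow> complex ^ 'n)" where
  "pinv ip W \<phi> = (THE \<psi>. \<psi> \<in> extensional W \<and> is_pinv ip W \<phi> \<psi>)"


section \<open>Gamma number\<close>

text \<open>
  \<open>iterated_deriv f vs x\<close> is the value of the \<open>k\<close>-linear map \<open>d\<^sub>x\<^sup>kf\<close> at the \<open>k\<close> vectors \<open>vs\<close>. The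
  library's Frechet derivative is real; for a polynomial \<open>f\<close> it is complex linear and so equals the
  complex derivative.
\<close>

primrec iterated_deriv :: "(complex ^ 'n \<Rightarrow> complex) \<Rightarrow> (complex ^ 'n) list \<Rightarrow> complex ^ 'n \<Rightarrow> complex" where
  "iterated_deriv f [] = f"
| "iterated_deriv f (v # vs) = (\<lambda>x. frechet_derivative (iterated_deriv f vs) (at x) v)"

definition system_deriv :: "'n::finite poly_system \<Rightarrow> complex ^ 'n \<Rightarrow> (complex ^ 'n) list \<Rightarrow> complex list" where
  "system_deriv F x vs = map (\<lambda>f. iterated_deriv f vs x) F"

abbreviation system_deriv1 :: "'n::finite poly_system \<Rightarrow> complex ^ 'n \<Rightarrow> complex ^ 'n \<Rightarrow> complex list" where
  "system_deriv1 F x \<equiv> (\<lambda>v. system_deriv F x [v])"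

definition system_pinv :: "'n::finite poly_system \<Rightarrow> complex ^ 'n \<Rightarrow> complex list \<Rightarrow> complex ^ 'n" where
  "system_pinv F x =
     pinv (list_cinner (\<lambda>a b. a * cnj b)) {w. length w = length F} (system_deriv1 F x)"

definition multilinear_norm :: "nat \<Rightarrow> ((complex ^ 'n) list \<Rightarrow> complex ^ 'n) \<Rightarrow> real" where
  "multilinear_norm k M =
     (SUP vs \<in> {vs. length vs = k \<and> (\<forall>v\<in>set vs. norm v \<le> 1)}. norm (M vs))"

definition gamma_number :: "'n::finite poly_system \<Rightarrow> complex ^ 'n \<Rightarrow> ereal" where
  "gamma_number F x =
     (if range (system_deriv1 F x) = {w. length w = length F}
      then (SUP k \<in> {2..}. ereal (root (k - 1)
              (multilinear_norm k (\<lambda>vs. (1 / fact k) *\<^sub>R system_pinv F x (system_deriv F x vs)))))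
      else \<infinity>)"


section \<open>Incidence condition number and split gamma number\<close>

definition hermitian_perp :: "(complex ^ 'n) set \<Rightarrow> (complex ^ 'n) set" where
  "hermitian_perp S = {w. \<forall>v\<in>S. cinner w v = 0}"

definition orth_proj :: "(complex ^ 'n) set \<Rightarrow> complex ^ 'n \<Rightarrow> complex ^ 'n" where
  "orth_proj E v = (THE p. p \<in> E \<and> v - p \<in> hermitian_perp E)"

text \<open>The product \<open>E\<^sub>1 \<times> \<dots> \<times> E\<^sub>r\<close> is \<^const>\<open>listset\<close> of the list of the \<open>E\<^sub>i\<close>.\<close>

definition proj_map :: "(complex ^ 'n) set list \<Rightarrow> complex ^ 'n \<Rightarrow> (complex ^ 'n) list" where
  "proj_map Es v = map (\<lambda>E. orth_proj E v) Es"

definition subspace_cond :: "(complex ^ 'n) set list \<Rightarrow> ereal" where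
  "subspace_cond Es =
     (if range (proj_map Es) = listset Es
      then ereal (SUP ws \<in> {ws \<in> listset Es. list_norm ws \<le> 1}.
             norm (pinv (list_cinner cinner) (listset Es) (proj_map Es) ws))
      else \<infinity>)"

definition deriv_ker :: "'n::finite poly_system \<Rightarrow> complex ^ 'n \<Rightarrow> (complex ^ 'n) set" where
  "deriv_ker F x = {v. system_deriv1 F x v = replicate (length F) 0}"

definition incidence_cond :: "'n::finite poly_system list \<Rightarrow> complex ^ 'n \<Rightarrow> ereal" where
  "incidence_cond Fs x = subspace_cond (map (\<lambda>F. hermitian_perp (deriv_ker F x)) Fs)"

text \<open>In \<^typ>\<open>ereal\<close>, \<open>0 * \<infinity> = 0\<close>; here a product with an infinite factor has to be infinite.\<close>

definition inf_times :: "ereal \<Rightarrow> ereal \<Rightarrow> ereal" (infixl \<open>*\<^sub>\<infinity>\<close> 70) where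
  "a *\<^sub>\<infinity> b = (if a = \<infinity> \<or> b = \<infinity> then \<infinity> else a * b)"

definition ereal_l2 :: "ereal list \<Rightarrow> ereal" where
  "ereal_l2 as = (if \<infinity> \<in> set as then \<infinity> else ereal (sqrt (\<Sum>a\<leftarrow>as. (real_of_ereal a)\<^sup>2)))"

definition split_gamma :: "'n::finite poly_system list \<Rightarrow> complex ^ 'n \<Rightarrow> ereal" where
  "split_gamma Fs x = incidence_cond Fs x *\<^sub>\<infinity> ereal_l2 (map (\<lambda>F. gamma_number F x) Fs)"

end

theory Submission
  imports Defs
begin

text \<open>
  Write \<open>L\<^sub>i\<close> and \<open>L\<close> for the derivatives of \<open>F\<^sub>i\<close> and \<open>G\<close> at \<open>x\<close>, \<open>E\<^sub>i = (ker L\<^sub>i)\<^sup>\<bottom>\<close>, and \<open>\<pi>\<^sub>i\<close> for the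
  orthogonal projection onto \<open>E\<^sub>i\<close>. The map \<open>L\<close> is surjective iff all \<open>L\<^sub>i\<close> and \<open>proj(E\<^sub>1, \<dots>, E\<^sub>r)\<close> are.
  In that case \<open>b = L\<^sup>\<dagger> d\<^sup>kG / k!\<close> takes values in \<open>(ker L)\<^sup>\<bottom>\<close> and \<open>\<pi>\<^sub>i b = L\<^sub>i\<^sup>\<dagger> d\<^sup>kF\<^sub>i / k!\<close>.
  Since \<open>\<pi>\<^sub>i\<close> is a contraction, \<open>\<gamma>(F\<^sub>i) \<le> \<gamma>(G)\<close>, which gives the second inequality. On \<open>(ker L)\<^sup>\<bottom>\<close> one has
  \<open>|v|\<^sup>2 \<le> \<kappa>\<^sup>2 \<Sum> |\<pi>\<^sub>i v|\<^sup>2\<close>, so \<open>|b|\<^sup>2 \<le> \<kappa>\<^sup>2 \<Sum> \<gamma>(F\<^sub>i)\<^sup>2\<^sup>(\<^sup>k\<^sup>-\<^sup>1\<^sup>)\<close>; with \<open>\<kappa> \<ge> 1\<close> this is at most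
  \<open>(\<kappa>\<^sup>2 \<Sum> \<gamma>(F\<^sub>i)\<^sup>2)\<^sup>k\<^sup>-\<^sup>1\<close>, which gives the first.
\<close>

section \<open>Polynomial maps and their iterated derivatives\<close>

text \<open>An inductive class of polynomials with no degree attached, hence closed under partial
  derivatives; the argument can differentiate repeatedly without tracking degrees.\<close>

inductive polynomial_map :: "(complex ^ 'n \<Rightarrow> complex) \<Rightarrow> bool" where
  const: "polynomial_map (\<lambda>x. c)"
| coord: "polynomial_map (\<lambda>x. x $ i)"
| add: "polynomial_map f \<Longrightarrow> polynomial_map g \<Longrightarrow> polynomial_map (\<lambda>x. f x + g x)"
| mult: "polynomial_map f \<Longrightarrow> polynomial_map g \<Longrightarrow> polynomial_map (\<lambda>x. f x * g x)"

lemma polynomial_map_sum: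
  "(\<And>a. a \<in> A \<Longrightarrow> polynomial_map (f a)) \<Longrightarrow> polynomial_map (\<lambda>x. \<Sum>a\<in>A. f a x)"
  by (induction A rule: infinite_finite_induct) (auto intro: polynomial_map.intros)

lemma polynomial_map_prod:
  "(\<And>a. a \<in> A \<Longrightarrow> polynomial_map (f a)) \<Longrightarrow> polynomial_map (\<lambda>x. \<Prod>a\<in>A. f a x)"
  by (induction A rule: infinite_finite_induct) (auto intro: polynomial_map.intros)

lemma polynomial_map_power:
  "polynomial_map f \<Longrightarrow> polynomial_map (\<lambda>x. f x ^ k)"
  by (induction k) (auto intro: polynomial_map.intros)

lemma homogeneous_poly_imp_polynomial_map:
  assumes "homogeneous_poly d f"
  shows "polynomial_map f"
proof -
  obtain c where f: "f = (\<lambda>x. \<Sum>m \<in> {m. (\<Sum>i\<in>UNIV. m i) = d}. c m * (\<Prod>i\<in>UNIV. (x $ i) ^ m i))"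
    using assms unfolding homogeneous_poly_def fun_eq_iff by blast
  show ?thesis
    unfolding f
    by (intro polynomial_map_sum polynomial_map_prod polynomial_map_power polynomial_map.intros)
qed

text \<open>Structural induction with the sum and product rules. The functions \<open>g i\<close>
  are the partial derivatives: the derivative is complex linear in the direction, and its
  coefficients are again polynomial, so differentiation can be iterated.\<close>

lemma polynomial_map_has_derivative:
  fixes f :: "complex ^ 'n::finite \<Rightarrow> complex"
  assumes "polynomial_map f"
  shows "\<exists>g. (\<forall>i. polynomial_map (g i)) \<and>
           (\<forall>x. (f has_derivative (\<lambda>v. \<Sum>i\<in>UNIV. v $ i * g i x)) (at x))"
  using assms
proof induction
  case (const c)
  show ?case
    by (rule exI[of _ "\<lambda>i x. 0"]) (auto intro: polynomial_map.intros)
next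
  case (coord j)
  have "((\<lambda>x. x $ j) has_derivative (\<lambda>v. \<Sum>i\<in>UNIV. v $ i * (if i = j then 1 else 0))) (at x)"
    for x :: "complex ^ 'n"
    using bounded_linear.has_derivative[OF bounded_linear_vec_nth[of j] has_derivative_ident]
    by (simp add: if_distrib cong: if_cong)
  then show ?case
    by (intro exI[of _ "\<lambda>i x. if i = j then 1 else 0"]) (auto intro: polynomial_map.intros)
next
  case (add f g)
  then obtain f' g' where
    "\<forall>i. polynomial_map (f' i)" "\<forall>x. (f has_derivative (\<lambda>v. \<Sum>i\<in>UNIV. v $ i * f' i x)) (at x)"
    "\<forall>i. polynomial_map (g' i)" "\<forall>x. (g has_derivative (\<lambda>v. \<Sum>i\<in>UNIV. v $ i * g' i x)) (at x)"
    by blast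
  then show ?case
    by (intro exI[of _ "\<lambda>i x. f' i x + g' i x"])
      (auto intro!: polynomial_map.intros derivative_eq_intros
        simp: sum.distrib distrib_left)
next
  case (mult f g)
  then obtain f' g' where
    "\<forall>i. polynomial_map (f' i)" "\<And>x. (f has_derivative (\<lambda>v. \<Sum>i\<in>UNIV. v $ i * f' i x)) (at x)"
    "\<forall>i. polynomial_map (g' i)" "\<And>x. (g has_derivative (\<lambda>v. \<Sum>i\<in>UNIV. v $ i * g' i x)) (at x)"
    by blast
  moreover from has_derivative_mult[OF this(2) this(4)]
  have "((\<lambda>x. f x * g x) has_derivative
      (\<lambda>v. \<Sum>i\<in>UNIV. v $ i * (f x * g' i x + f' i x * g x))) (at x)" for x
    by (simp add: sum.distrib distrib_left sum_distrib_left sum_distrib_right mult_ac)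
  ultimately show ?case
    using mult.hyps
    by (intro exI[of _ "\<lambda>i x. f x * g' i x + f' i x * g x"])
      (auto intro!: polynomial_map.intros)
qed

lemma polynomial_map_frechet_derivative:
  fixes f :: "complex ^ 'n::finite \<Rightarrow> complex"
  assumes "polynomial_map f"
  obtains g where "\<And>i. polynomial_map (g i)"
    and "\<And>x v. frechet_derivative f (at x) v = (\<Sum>i\<in>UNIV. v $ i * g i x)"
proof -
  from polynomial_map_has_derivative[OF assms] obtain g where
    g: "\<And>i. polynomial_map (g i)"
    and f: "\<And>x. (f has_derivative (\<lambda>v. \<Sum>i\<in>UNIV. v $ i * g i x)) (at x)"
    by blast
  show ?thesis
    by (rule that[of g]) (simp_all add: g frechet_derivative_at[OF f, symmetric])
qed

lemma polynomial_map_has_frechet_derivative: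
  fixes f :: "complex ^ 'n::finite \<Rightarrow> complex"
  assumes "polynomial_map f"
  shows "(f has_derivative frechet_derivative f (at x)) (at x)"
  using polynomial_map_has_derivative[OF assms] frechet_derivative_works differentiable_def
  by blast

lemma polynomial_map_iterated_deriv:
  fixes f :: "complex ^ 'n::finite \<Rightarrow> complex"
  assumes "polynomial_map f"
  shows "polynomial_map (iterated_deriv f vs)"
proof (induction vs)
  case (Cons v vs)
  obtain g where "\<And>i. polynomial_map (g i)"
    and "\<And>x v. frechet_derivative (iterated_deriv f vs) (at x) v = (\<Sum>i\<in>UNIV. v $ i * g i x)"
    using polynomial_map_frechet_derivative[OF Cons.IH] by metis
  then show ?case
    by (auto intro!: polynomial_map_sum polynomial_map.intros)
qed (use assms in simp)

lemma iterated_deriv_append: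
  "iterated_deriv f (us @ vs) = iterated_deriv (iterated_deriv f vs) us"
  by (induction us) auto

lemma iterated_deriv_linear_combination:
  fixes g :: "'a \<Rightarrow> complex ^ 'n::finite \<Rightarrow> complex"
  assumes "\<And>i. polynomial_map (g i)"
  shows "iterated_deriv (\<lambda>x. \<Sum>i\<in>A. c i * g i x) vs = (\<lambda>x. \<Sum>i\<in>A. c i * iterated_deriv (g i) vs x)"
proof (induction vs)
  case (Cons v vs)
  have "((\<lambda>x. \<Sum>i\<in>A. c i * iterated_deriv (g i) vs x) has_derivative
      (\<lambda>v. \<Sum>i\<in>A. c i * frechet_derivative (iterated_deriv (g i) vs) (at x) v)) (at x)" for x
    by (intro has_derivative_sum has_derivative_mult_right
        polynomial_map_has_frechet_derivative polynomial_map_iterated_deriv assms)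
  from frechet_derivative_at[OF this] show ?case
    by (simp add: Cons.IH fun_eq_iff)
qed simp

text \<open>Induction on the order, replacing \<open>f\<close> by its partial derivatives. The bound
  guarantees that the real suprema taken later are over bounded sets.\<close>

lemma iterated_deriv_bounded:
  fixes f :: "complex ^ 'n::finite \<Rightarrow> complex"
  assumes "polynomial_map f"
  shows "\<exists>C. \<forall>vs. length vs = k \<and> (\<forall>v\<in>set vs. norm v \<le> 1) \<longrightarrow> norm (iterated_deriv f vs x) \<le> C"
  using assms
proof (induction k arbitrary: f)
  case (Suc k)
  obtain g where g: "\<And>i. polynomial_map (g i)"
    and fg: "\<And>x v. frechet_derivative f (at x) v = (\<Sum>i\<in>UNIV. v $ i * g i x)"
    using polynomial_map_frechet_derivative[OF Suc.prems] by metis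
  obtain C where C: "\<And>i vs. length vs = k \<Longrightarrow> \<forall>v\<in>set vs. norm v \<le> 1 \<Longrightarrow>
      norm (iterated_deriv (g i) vs x) \<le> C i"
    using Suc.IH[OF g] by metis
  have "norm (iterated_deriv f ws x) \<le> (\<Sum>i\<in>UNIV. C i)"
    if ws: "length ws = Suc k" "\<forall>v\<in>set ws. norm v \<le> 1" for ws
  proof -
    \<comment> \<open>The last vector of the list is the direction differentiated first, so removing
      it turns \<open>f\<close> into a combination of its partial derivatives with constant
      coefficients \<open>v $ i\<close>.\<close>
    obtain vs v where ws_eq: "ws = vs @ [v]"
      using ws(1) by (cases ws rule: rev_cases) auto
    have "iterated_deriv f ws x = (\<Sum>i\<in>UNIV. v $ i * iterated_deriv (g i) vs x)"
      by (simp add: ws_eq iterated_deriv_append fg iterated_deriv_linear_combination[OF g])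
    also have "norm \<dots> \<le> (\<Sum>i\<in>UNIV. norm (v $ i) * norm (iterated_deriv (g i) vs x))"
      by (metis (mono_tags, lifting) norm_mult norm_sum sum.cong)
    also have "\<dots> \<le> (\<Sum>i\<in>UNIV. 1 * C i)"
    proof (intro sum_mono mult_mono)
      fix i
      show "norm (v $ i) \<le> 1"
        using ws ws_eq Finite_Cartesian_Product.norm_nth_le[of v i] by auto
      show "norm (iterated_deriv (g i) vs x) \<le> C i"
        using C ws ws_eq by auto
    qed auto
    finally show ?thesis by simp
  qed
  then show ?case by blast
qed auto


section \<open>Hermitian geometry\<close>

lemma cinner_add_left: "cinner (u + v) w = cinner u w + cinner v w"
  and cinner_diff_left: "cinner (u - v) w = cinner u w - cinner v w"
  and cinner_diff_right: "cinner w (u - v) = cinner w u - cinner w v"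
  and cinner_scale_left: "cinner (c *s v) w = c * cinner v w"
  and cinner_scale_right: "cinner v (c *s w) = cnj c * cinner v w"
  and cinner_zero_left [simp]: "cinner 0 w = 0"
  and cinner_zero_right [simp]: "cinner w 0 = 0"
  and cinner_commute: "cinner v w = cnj (cinner w v)"
  by (simp_all add: cinner_def sum.distrib sum_subtractf sum_distrib_left algebra_simps)

lemma inner_eq_Re_cinner: "v \<bullet> w = Re (cinner v w)"
  by (simp add: cinner_def inner_vec_def inner_complex_def)

lemma cinner_self_eq_zero: "cinner v v = 0 \<Longrightarrow> v = 0"
  using inner_eq_Re_cinner[of v v] by simp

lemma scaleR_eq_vector_scale: "c *\<^sub>R v = complex_of_real c *s (v :: complex ^ 'n)"
  by (simp add: vec_eq_iff scaleR_conv_of_real[where 'a = complex])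

lemma vec_subspace_imp_subspace:
  fixes K :: "(complex ^ 'n) set"
  assumes "vec.subspace K"
  shows "subspace K"
  using assms
  by (simp add: subspace_def vec.subspace_def scaleR_eq_vector_scale)

lemma vec_subspace_hermitian_perp: "vec.subspace (hermitian_perp S)"
  by (auto simp: vec.subspace_def hermitian_perp_def cinner_add_left cinner_scale_left)

lemma hermitian_perp_disjoint:
  "v \<in> K \<Longrightarrow> v \<in> hermitian_perp K \<Longrightarrow> v = 0"
  by (auto simp: hermitian_perp_def intro: cinner_self_eq_zero)

text \<open>On a complex subspace, real and Hermitian orthogonality agree, so the real
  orthogonal decomposition can be used.\<close>

lemma hermitian_decomp:
  fixes K :: "(complex ^ 'n) set"
  assumes "vec.subspace K"
  obtains p where "p \<in> hermitian_perp K" "v - p \<in> K"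
proof -
  obtain y z where y: "y \<in> span K" and z: "\<And>w. w \<in> span K \<Longrightarrow> orthogonal z w" and v: "v = y + z"
    using orthogonal_subspace_decomp_exists by metis
  have K: "span K = K"
    using vec_subspace_imp_subspace[OF assms] by (simp add: span_eq_iff)
  have "cinner z w = 0" if "w \<in> K" for w
  proof -
    \<comment> \<open>As \<open>cinner z (\<i> *s w)\<close> equals
      \<open>- \<i> * cinner z w\<close>, its real part is the imaginary part of
      \<open>cinner z w\<close>.\<close>
    have "\<i> *s w \<in> K"
      using assms that by (simp add: vec.subspace_scale)
    then have "Re (cinner z w) = 0" "Re (cinner z (\<i> *s w)) = 0"
      using z that by (simp_all add: K orthogonal_def inner_eq_Re_cinner)
    then show ?thesis
      by (simp add: cinner_scale_right complex_eq_iff)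
  qed
  then show ?thesis
    using that[of z] y v K by (simp add: hermitian_perp_def)
qed

text \<open>If \<open>v\<close> is orthogonal to the complement of \<open>K\<close>, its component
  \<open>p\<close> in that complement is orthogonal both to \<open>v\<close> and to
  \<open>v - p\<close>, hence to itself.\<close>

lemma hermitian_perp_perp:
  fixes K :: "(complex ^ 'n) set"
  assumes "vec.subspace K"
  shows "hermitian_perp (hermitian_perp K) = K"
proof (intro equalityI subsetI)
  fix v assume v: "v \<in> hermitian_perp (hermitian_perp K)"
  obtain p where p: "p \<in> hermitian_perp K" "v - p \<in> K"
    using hermitian_decomp[OF assms] by blast
  have "cinner v p = 0" "cinner (v - p) p = 0"
    using v p cinner_commute[of "v - p" p] by (auto simp: hermitian_perp_def)
  then have "p = 0"
    by (auto simp: cinner_diff_left intro: cinner_self_eq_zero)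
  then show "v \<in> K" using p by simp
next
  fix v assume "v \<in> K"
  then show "v \<in> hermitian_perp (hermitian_perp K)"
    using cinner_commute[of v] by (auto simp: hermitian_perp_def)
qed

section \<open>Orthogonal projections onto complements of complex subspaces\<close>

lemma orth_proj_perp_unique:
  fixes K :: "(complex ^ 'n) set"
  assumes K: "vec.subspace K" and p: "p \<in> hermitian_perp K" "v - p \<in> K"
  shows "orth_proj (hermitian_perp K) v = p"
  unfolding orth_proj_def hermitian_perp_perp[OF K]
proof (rule the_equality)
  fix q assume q: "q \<in> hermitian_perp K \<and> v - q \<in> K"
  \<comment> \<open>The difference of two candidates for the projection lies both in
    \<open>K\<close> and in its complement.\<close>
  have "(v - p) - (v - q) \<in> K"
    using vec.subspace_diff[OF K] p q by blast
  moreover have "q - p \<in> hermitian_perp K"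
    using vec.subspace_diff[OF vec_subspace_hermitian_perp] p q by blast
  ultimately show "q = p"
    using hermitian_perp_disjoint[of "q - p" K] by simp
qed (use p in simp)

lemma orth_proj_perp:
  fixes K :: "(complex ^ 'n) set"
  assumes K: "vec.subspace K"
  shows "orth_proj (hermitian_perp K) v \<in> hermitian_perp K"
    and "v - orth_proj (hermitian_perp K) v \<in> K"
proof -
  obtain p where "p \<in> hermitian_perp K" "v - p \<in> K"
    using hermitian_decomp[OF K] by blast
  with orth_proj_perp_unique[OF K this]
  show "orth_proj (hermitian_perp K) v \<in> hermitian_perp K"
    and "v - orth_proj (hermitian_perp K) v \<in> K"
    by auto
qed

lemma orth_proj_perp_eq_iff:
  fixes K :: "(complex ^ 'n) set"
  assumes K: "vec.subspace K"
  shows "orth_proj (hermitian_perp K) u = orth_proj (hermitian_perp K) v \<longleftrightarrow> u - v \<in> K"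
proof
  let ?P = "orth_proj (hermitian_perp K)"
  assume "?P u = ?P v"
  then show "u - v \<in> K"
    using vec.subspace_diff[OF K orth_proj_perp(2)[OF K, of u] orth_proj_perp(2)[OF K, of v]]
    by simp
next
  assume "u - v \<in> K"
  from vec.subspace_add[OF K this orth_proj_perp(2)[OF K, of v]]
  show "orth_proj (hermitian_perp K) u = orth_proj (hermitian_perp K) v"
    by (intro orth_proj_perp_unique[OF K] orth_proj_perp(1)[OF K]) simp
qed

lemma linear_orth_proj_perp:
  fixes K :: "(complex ^ 'n) set"
  assumes K: "vec.subspace K"
  shows "linear (orth_proj (hermitian_perp K))"
proof
  let ?P = "orth_proj (hermitian_perp K)"
  note P = orth_proj_perp[OF K]
  show "?P (u + v) = ?P u + ?P v" for u v
    using vec.subspace_add[OF K P(2)[of u] P(2)[of v]]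
    by (intro orth_proj_perp_unique[OF K] vec.subspace_add[OF vec_subspace_hermitian_perp] P(1))
      (simp add: algebra_simps)
  show "?P (c *\<^sub>R v) = c *\<^sub>R ?P v" for c v
    using vec.subspace_scale[OF K P(2)[of v], of "complex_of_real c"]
    by (intro orth_proj_perp_unique[OF K])
      (auto simp: scaleR_eq_vector_scale vec.scale_right_diff_distrib
        intro!: vec.subspace_scale[OF vec_subspace_hermitian_perp] P(1))
qed

lemma norm_orth_proj_perp_le:
  fixes K :: "(complex ^ 'n) set"
  assumes K: "vec.subspace K"
  shows "norm (orth_proj (hermitian_perp K) v) \<le> norm v"
proof -
  let ?p = "orth_proj (hermitian_perp K) v"
  note p = orth_proj_perp[OF K, of v]
  have "orthogonal ?p (v - ?p)"
    using p by (simp add: orthogonal_def inner_eq_Re_cinner hermitian_perp_def)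
  from norm_add_Pythagorean[OF this] have "(norm v)\<^sup>2 = (norm ?p)\<^sup>2 + (norm (v - ?p))\<^sup>2"
    by simp
  then show ?thesis
    by (metis le_add_same_cancel1 norm_ge_zero power2_le_imp_le zero_le_power2)
qed

text \<open>For a surjective map the third Penrose equation is vacuous, so the Hermitian product on the
  target plays no role.\<close>

lemma pinv_surj:
  fixes \<phi> :: "complex ^ 'n \<Rightarrow> 'b"
  assumes K: "vec.subspace K" and \<phi>: "\<And>u v. \<phi> u = \<phi> v \<longleftrightarrow> u - v \<in> K" and W: "range \<phi> = W"
  shows pinv_surj_perp: "w \<in> W \<Longrightarrow> pinv ip W \<phi> w \<in> hermitian_perp K"
    and pinv_surj_right: "w \<in> W \<Longrightarrow> \<phi> (pinv ip W \<phi> w) = w"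
    and pinv_surj_left: "v \<in> hermitian_perp K \<Longrightarrow> pinv ip W \<phi> (\<phi> v) = v"
proof -
  \<comment> \<open>The fibres of \<open>\<phi>\<close> are the cosets of \<open>K\<close>; this
    stands in for linearity, since lists have no vector space structure. Consequently
    \<open>\<phi>\<close> is injective on the complement of \<open>K\<close>.\<close>
  have uniq: "u = v" if "u \<in> hermitian_perp K" "v \<in> hermitian_perp K" "\<phi> u = \<phi> v" for u v
  proof -
    have "u - v \<in> K" "u - v \<in> hermitian_perp K"
      using that \<phi> vec.subspace_diff[OF vec_subspace_hermitian_perp] by auto
    then show ?thesis using hermitian_perp_disjoint[of "u - v" K] by simp
  qed
  have "\<exists>v. v \<in> hermitian_perp K \<and> \<phi> v = w" if w: "w \<in> W" for w
  proof -
    obtain u where "\<phi> u = w" using w W by auto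
    moreover obtain p where "p \<in> hermitian_perp K" "u - p \<in> K"
      using hermitian_decomp[OF K] by blast
    ultimately show ?thesis using \<phi> by metis
  qed
  then obtain \<psi>0 where \<psi>0: "\<And>w. w \<in> W \<Longrightarrow> \<psi>0 w \<in> hermitian_perp K \<and> \<phi> (\<psi>0 w) = w"
    by metis
  define \<psi> where "\<psi> = restrict \<psi>0 W"
  have \<psi>: "\<psi> w \<in> hermitian_perp K" "\<phi> (\<psi> w) = w" if "w \<in> W" for w
    using \<psi>0 that by (auto simp: \<psi>_def)
  have \<phi>W: "\<phi> v \<in> W" for v using W by auto
  \<comment> \<open>\<open>\<psi>\<close> takes values in the complement of \<open>K\<close>, while
    \<open>v' - \<psi> (\<phi> v')\<close> lies in \<open>K\<close>. The right-hand side is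
    Hermitian symmetric in \<open>v\<close> and \<open>v'\<close>, which yields the fourth Penrose
    equation.\<close>
  have P: "cinner (\<psi> (\<phi> v)) v' = cinner (\<psi> (\<phi> v)) (\<psi> (\<phi> v'))" for v v'
  proof -
    have "v' - \<psi> (\<phi> v') \<in> K" using \<phi> \<psi>(2)[OF \<phi>W] by metis
    then have "cinner (\<psi> (\<phi> v)) (v' - \<psi> (\<phi> v')) = 0"
      using \<psi>(1)[OF \<phi>W, of v] unfolding hermitian_perp_def by blast
    then show ?thesis by (simp add: cinner_diff_right)
  qed
  have "pinv ip W \<phi> = \<psi>"
    unfolding pinv_def
  proof (rule the_equality)
    have "cinner (\<psi> (\<phi> v)) v' = cinner v (\<psi> (\<phi> v'))" for v v'
      using P[of v v'] P[of v' v] cinner_commute by metis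
    then show "\<psi> \<in> extensional W \<and> is_pinv ip W \<phi> \<psi>"
      using \<psi> \<phi>W by (auto simp: is_pinv_def) (simp add: \<psi>_def)
  next
    fix \<eta> assume \<eta>: "\<eta> \<in> extensional W \<and> is_pinv ip W \<phi> \<eta>"
    then have adj: "cinner (\<eta> (\<phi> v)) v' = cinner v (\<eta> (\<phi> v'))" and pen: "\<phi> (\<eta> (\<phi> v)) = \<phi> v" for v v'
      by (auto simp: is_pinv_def)
    have zero: "\<eta> (\<phi> 0) = 0"
      using adj[of 0 "\<eta> (\<phi> 0)"] by (auto intro: cinner_self_eq_zero)
    show "\<eta> = \<psi>"
    proof (rule extensionalityI[of _ W])
      fix w assume w: "w \<in> W"
      then obtain v where v: "w = \<phi> v" using W by auto
      \<comment> \<open>Self-adjointness moves \<open>\<eta> \<circ> \<phi>\<close> onto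
        \<open>k\<close>, where it vanishes. So \<open>\<eta> w\<close> is in the complement of
        \<open>K\<close>, and the first Penrose equation makes it a preimage of \<open>w\<close>;
        \<open>uniq\<close> then identifies it.\<close>
      have "cinner (\<eta> w) k = 0" if "k \<in> K" for k
      proof -
        have "\<phi> k = \<phi> 0" using \<phi> that by simp
        then show ?thesis using adj[of v k] zero v by simp
      qed
      then have "\<eta> w \<in> hermitian_perp K" by (simp add: hermitian_perp_def)
      then show "\<eta> w = \<psi> w" using uniq \<psi> w pen v by metis
    qed (use \<eta> in \<open>auto simp: \<psi>_def\<close>)
  qed
  then show "w \<in> W \<Longrightarrow> pinv ip W \<phi> w \<in> hermitian_perp K"
    and "w \<in> W \<Longrightarrow> \<phi> (pinv ip W \<phi> w) = w"
    and "v \<in> hermitian_perp K \<Longrightarrow> pinv ip W \<phi> (\<phi> v) = v"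
    using \<psi> uniq \<phi>W by metis+
qed

section \<open>Euclidean norms of tuples and a compactness bound\<close>

lemma list_norm_nonneg: "0 \<le> list_norm ws"
  by (auto simp: list_norm_def intro!: sum_list_nonneg)

lemma norm_le_list_norm: "w \<in> set ws \<Longrightarrow> norm w \<le> list_norm ws"
  unfolding list_norm_def
  by (rule real_le_rsqrt) (auto intro!: member_le_sum_list)

lemma list_norm_scaleR: "list_norm (map ((*\<^sub>R) c) ws) = \<bar>c\<bar> * list_norm ws"
  by (simp add: list_norm_def power_mult_distrib sum_list_const_mult real_sqrt_mult o_def)

lemma list_norm_mono:
  "(\<And>a. a \<in> set xs \<Longrightarrow> norm (f a) \<le> g a) \<Longrightarrow>
    list_norm (map f xs) \<le> sqrt (\<Sum>a\<leftarrow>xs. (g a)\<^sup>2)"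
  by (auto simp: list_norm_def intro!: sum_list_mono power_mono)

text \<open>By compactness of the unit sphere of \<open>S\<close>, the norm of the tuple of values
  attains a minimum there. Joint injectivity makes it positive, and its reciprocal serves as
  \<open>C\<close> by homogeneity.\<close>

lemma linear_family_bounded_below:
  fixes gs :: "('a::euclidean_space \<Rightarrow> 'b::real_normed_vector) list"
  assumes S: "subspace S" and lin: "\<And>g. g \<in> set gs \<Longrightarrow> linear g"
    and inj: "\<And>v. v \<in> S \<Longrightarrow> \<forall>g\<in>set gs. g v = 0 \<Longrightarrow> v = 0"
  obtains C where "0 \<le> C" and "\<And>v. v \<in> S \<Longrightarrow> norm v \<le> C * list_norm (map (\<lambda>g. g v) gs)"
proof -
  let ?h = "\<lambda>v. list_norm (map (\<lambda>g. g v) gs)"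
  let ?B = "sphere 0 1 \<inter> S"
  have "continuous_on A (\<lambda>v. \<Sum>g\<leftarrow>gs. (norm (g v))\<^sup>2)" for A
    using lin
    by (induction gs)
      (auto intro!: continuous_on_add continuous_on_power continuous_on_norm
        intro: linear_continuous_on linear_conv_bounded_linear[THEN iffD1])
  then have cont: "continuous_on ?B ?h"
    by (auto simp: list_norm_def o_def intro!: continuous_intros)
  have h_scale: "?h (c *\<^sub>R v) = \<bar>c\<bar> * ?h v" for c v
  proof -
    have "map (\<lambda>g. g (c *\<^sub>R v)) gs = map ((*\<^sub>R) c) (map (\<lambda>g. g v) gs)"
      using lin by (simp add: linear_scale)
    then show ?thesis by (simp only: list_norm_scaleR)
  qed
  show ?thesis
  proof (cases "?B = {}")
    \<comment> \<open>Without unit vectors \<open>S\<close> is trivial, and \<open>C = 0\<close>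
      works.\<close>
    case True
    have "v = 0" if "v \<in> S" for v
    proof (rule ccontr)
      assume "v \<noteq> 0"
      then have "(1 / norm v) *\<^sub>R v \<in> ?B"
        using subspace_scale[OF S that] by simp
      with True show False by blast
    qed
    then show ?thesis using that[of 0] by fastforce
  next
    case False
    have "compact ?B"
      using closed_subspace[OF S] by (simp add: compact_Int_closed)
    from continuous_attains_inf[OF this False cont]
    obtain u where u: "u \<in> ?B" and min: "\<And>v. v \<in> ?B \<Longrightarrow> ?h u \<le> ?h v" by blast
    have "?h u \<noteq> 0"
    proof
      assume "?h u = 0"
      then have "\<forall>g\<in>set gs. g u = 0"
        using norm_le_list_norm[of _ "map (\<lambda>g. g u) gs"] by fastforce
      then show False using inj u by fastforce
    qed
    then have pos: "0 < ?h u" using list_norm_nonneg[of "map (\<lambda>g. g u) gs"] by simp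
    have "norm v \<le> (1 / ?h u) * ?h v" if "v \<in> S" for v
    proof (cases "v = 0")
      case True
      then show ?thesis using pos list_norm_nonneg[of "map (\<lambda>g. g v) gs"] by simp
    next
      case False
      then have "(1 / norm v) *\<^sub>R v \<in> ?B"
        using subspace_scale[OF S that] by simp
      from min[OF this] have "?h u \<le> ?h v / norm v"
        unfolding h_scale by simp
      then show ?thesis using False pos by (simp add: field_simps)
    qed
    then show ?thesis using that[of "1 / ?h u"] pos by simp
  qed
qed


section \<open>The derivative of a polynomial system\<close>

lemma iterated_deriv1_linear:
  fixes f :: "complex ^ 'n::finite \<Rightarrow> complex"
  assumes "polynomial_map f"
  shows iterated_deriv1_add: "iterated_deriv f [u + v] x = iterated_deriv f [u] x + iterated_deriv f [v] x"
    and iterated_deriv1_diff: "iterated_deriv f [u - v] x = iterated_deriv f [u] x - iterated_deriv f [v] x"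
    and iterated_deriv1_scale: "iterated_deriv f [c *s v] x = c * iterated_deriv f [v] x"
    and iterated_deriv1_zero: "iterated_deriv f [0] x = 0"
    and linear_iterated_deriv1: "linear (\<lambda>v. iterated_deriv f [v] x)"
proof -
  obtain g where g: "\<And>x v. frechet_derivative f (at x) v = (\<Sum>i\<in>UNIV. v $ i * g i x)"
    using polynomial_map_frechet_derivative[OF assms] by metis
  show "iterated_deriv f [u + v] x = iterated_deriv f [u] x + iterated_deriv f [v] x"
    and "iterated_deriv f [u - v] x = iterated_deriv f [u] x - iterated_deriv f [v] x"
    and "iterated_deriv f [c *s v] x = c * iterated_deriv f [v] x"
    and "iterated_deriv f [0] x = 0"
    and "linear (\<lambda>v. iterated_deriv f [v] x)"
    by (auto simp: g sum.distrib sum_subtractf sum_distrib_left scaleR_sum_right algebra_simps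
        intro!: linearI)
qed

definition polynomial_system :: "'n::finite poly_system \<Rightarrow> bool" where
  "polynomial_system F \<longleftrightarrow> (\<forall>f\<in>set F. polynomial_map f)"

lemma polynomial_system_concat:
  "\<forall>F\<in>set Fs. polynomial_system F \<Longrightarrow> polynomial_system (concat Fs)"
  by (auto simp: polynomial_system_def)

abbreviation deriv_surj :: "'n::finite poly_system \<Rightarrow> complex ^ 'n \<Rightarrow> bool" where
  "deriv_surj F x \<equiv> range (system_deriv1 F x) = {w. length w = length F}"

text \<open>The coimage of the derivative, realized inside the source space; it is not the quotient
  of the target by the image.\<close>

abbreviation deriv_coker :: "'n::finite poly_system \<Rightarrow> complex ^ 'n \<Rightarrow> (complex ^ 'n) set" where
  "deriv_coker F x \<equiv> hermitian_perp (deriv_ker F x)"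

lemma mem_deriv_ker_iff: "v \<in> deriv_ker F x \<longleftrightarrow> (\<forall>f\<in>set F. iterated_deriv f [v] x = 0)"
  by (simp add: deriv_ker_def system_deriv_def flip: map_replicate_const)

lemma vec_subspace_deriv_ker:
  assumes "polynomial_system F"
  shows "vec.subspace (deriv_ker F x)"
  using assms
  by (auto simp del: iterated_deriv.simps
      simp: iterated_deriv1_linear vec.subspace_def mem_deriv_ker_iff polynomial_system_def)

lemma system_deriv1_eq_iff:
  assumes "polynomial_system F"
  shows "system_deriv1 F x u = system_deriv1 F x v \<longleftrightarrow> u - v \<in> deriv_ker F x"
  using assms
  unfolding mem_deriv_ker_iff system_deriv_def map_eq_conv
  by (auto simp del: iterated_deriv.simps simp: iterated_deriv1_linear polynomial_system_def)

lemma length_system_deriv [simp]: "length (system_deriv F x vs) = length F"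
  by (simp add: system_deriv_def)

lemma system_pinv_surj:
  assumes F: "polynomial_system F" and surj: "deriv_surj F x"
  shows system_pinv_coker: "length w = length F \<Longrightarrow> system_pinv F x w \<in> deriv_coker F x"
    and system_pinv_right: "length w = length F \<Longrightarrow> system_deriv1 F x (system_pinv F x w) = w"
    and system_pinv_left: "v \<in> deriv_coker F x \<Longrightarrow> system_pinv F x (system_deriv1 F x v) = v"
proof -
  note pinv = pinv_surj[OF vec_subspace_deriv_ker[OF F] system_deriv1_eq_iff[OF F] surj,
      where ip = "list_cinner (\<lambda>a b. a * cnj b)", folded system_pinv_def]
  show "length w = length F \<Longrightarrow> system_pinv F x w \<in> deriv_coker F x"
    and "length w = length F \<Longrightarrow> system_deriv1 F x (system_pinv F x w) = w"
    and "v \<in> deriv_coker F x \<Longrightarrow> system_pinv F x (system_deriv1 F x v) = v"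
    using pinv by auto
qed

text \<open>A vector and its projection differ by an element of the kernel, so the derivative does
  not distinguish them; on the complement the pseudo-inverse is a left inverse.\<close>

lemma orth_proj_eq_system_pinv:
  assumes F: "polynomial_system F" and surj: "deriv_surj F x"
  shows "orth_proj (deriv_coker F x) v = system_pinv F x (system_deriv1 F x v)"
proof -
  note p = orth_proj_perp[OF vec_subspace_deriv_ker[OF F], where v = v]
  have "system_deriv1 F x v = system_deriv1 F x (orth_proj (deriv_coker F x) v)"
    using p(2) system_deriv1_eq_iff[OF F] by blast
  then show ?thesis
    using system_pinv_left[OF F surj p(1)] by simp
qed

section \<open>The terms of the gamma number and their norms\<close>

definition gamma_term :: "'n::finite poly_system \<Rightarrow> complex ^ 'n \<Rightarrow> nat \<Rightarrow> (complex ^ 'n) list \<Rightarrow> complex ^ 'n" where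
  "gamma_term F x k vs = (1 / fact k) *\<^sub>R system_pinv F x (system_deriv F x vs)"

abbreviation unit_lists :: "nat \<Rightarrow> (complex ^ 'n) list set" where
  "unit_lists k \<equiv> {vs. length vs = k \<and> (\<forall>v\<in>set vs. norm v \<le> 1)}"

lemma replicate_zero_unit_lists: "replicate k 0 \<in> unit_lists k"
  by simp

lemma gamma_number_eq_SUP:
  "deriv_surj F x \<Longrightarrow>
    gamma_number F x = (SUP k\<in>{2..}. ereal (root (k - 1) (multilinear_norm k (gamma_term F x k))))"
  by (simp add: gamma_number_def gamma_term_def[abs_def])

text \<open>The pseudo-inverse takes values in the complement of the kernel, where the derivative is
  bounded below. Its values are thus controlled by the entries of the \<open>k\<close>th derivative,
  which are bounded on unit vectors.\<close>

lemma bdd_above_gamma_term: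
  assumes F: "polynomial_system F" and surj: "deriv_surj F x"
  shows "bdd_above ((\<lambda>vs. norm (gamma_term F x k vs)) ` unit_lists k)"
proof -
  obtain B where B: "\<And>f vs. f \<in> set F \<Longrightarrow> vs \<in> unit_lists k \<Longrightarrow> norm (iterated_deriv f vs x) \<le> B f"
    using iterated_deriv_bounded[where k = k and x = x] F
    unfolding polynomial_system_def mem_Collect_eq by metis
  let ?gs = "map (\<lambda>f v. iterated_deriv f [v] x) F"
  have lin: "linear g" if "g \<in> set ?gs" for g
    using that F linear_iterated_deriv1
    by (auto simp: polynomial_system_def simp del: iterated_deriv.simps)
  have inj: "v = 0" if "v \<in> deriv_coker F x" "\<forall>g\<in>set ?gs. g v = 0" for v
    using that hermitian_perp_disjoint[of v "deriv_ker F x"]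
    by (simp add: mem_deriv_ker_iff del: iterated_deriv.simps)
  obtain C where C: "0 \<le> C"
    and bound: "\<And>v. v \<in> deriv_coker F x \<Longrightarrow> norm v \<le> C * list_norm (map (\<lambda>g. g v) ?gs)"
    by (rule linear_family_bounded_below[where gs = ?gs,
          OF vec_subspace_imp_subspace[OF vec_subspace_hermitian_perp] lin inj]) blast+
  have "norm (gamma_term F x k vs) \<le> 1 / fact k * (C * sqrt (\<Sum>f\<leftarrow>F. (B f)\<^sup>2))"
    if vs: "vs \<in> unit_lists k" for vs
  proof -
    let ?v = "system_pinv F x (system_deriv F x vs)"
    have "norm ?v \<le> C * list_norm (system_deriv1 F x ?v)"
      using bound[OF system_pinv_coker[OF F surj]] by (simp add: system_deriv_def o_def)
    also have "system_deriv1 F x ?v = system_deriv F x vs"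
      by (simp add: system_pinv_right[OF F surj])
    also have "C * list_norm \<dots> \<le> C * sqrt (\<Sum>f\<leftarrow>F. (B f)\<^sup>2)"
      unfolding system_deriv_def using B vs C by (intro mult_left_mono list_norm_mono) auto
    finally show ?thesis
      unfolding gamma_term_def norm_scaleR by (simp add: divide_right_mono)
  qed
  then show ?thesis by (rule bdd_aboveI2)
qed

lemma norm_gamma_term_le:
  assumes "polynomial_system F" "deriv_surj F x" "vs \<in> unit_lists k"
  shows "norm (gamma_term F x k vs) \<le> multilinear_norm k (gamma_term F x k)"
  unfolding multilinear_norm_def
  by (rule cSUP_upper[OF assms(3) bdd_above_gamma_term[OF assms(1,2)]])

lemma multilinear_norm_gamma_term_nonneg:
  assumes "polynomial_system F" "deriv_surj F x"
  shows "0 \<le> multilinear_norm k (gamma_term F x k)"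
  using norm_gamma_term_le[OF assms replicate_zero_unit_lists] norm_ge_zero order_trans by blast

lemma gamma_number_nonneg:
  assumes "polynomial_system F" "deriv_surj F x"
  shows "0 \<le> gamma_number F x"
  unfolding gamma_number_eq_SUP[OF assms(2)]
  using multilinear_norm_gamma_term_nonneg[OF assms, of 2] by (intro SUP_upper2[of 2]) auto

lemma multilinear_norm_le_gamma_power:
  assumes F: "polynomial_system F" and surj: "deriv_surj F x"
    and g: "gamma_number F x = ereal g" and k: "2 \<le> k"
  shows "multilinear_norm k (gamma_term F x k) \<le> g ^ (k - 1)"
proof -
  let ?N = "multilinear_norm k (gamma_term F x k)"
  have "ereal (root (k - 1) ?N) \<le> ereal g"
    unfolding g[symmetric] gamma_number_eq_SUP[OF surj] using k by (intro SUP_upper) auto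
  moreover have "0 \<le> ?N"
    by (rule multilinear_norm_gamma_term_nonneg[OF F surj])
  ultimately have "root (k - 1) ?N ^ (k - 1) \<le> g ^ (k - 1)"
    by (intro power_mono) (use k in \<open>auto intro: real_root_ge_zero\<close>)
  then show ?thesis using \<open>0 \<le> ?N\<close> k by simp
qed


section \<open>Concatenated systems\<close>

lemma mem_listset_iff: "ws \<in> listset Es \<longleftrightarrow> list_all2 (\<in>) ws Es"
  by (induction Es arbitrary: ws) (auto simp: set_Cons_def list_all2_Cons2)

abbreviation cokers :: "'n::finite poly_system list \<Rightarrow> complex ^ 'n \<Rightarrow> (complex ^ 'n) set list" where
  "cokers Fs x \<equiv> map (\<lambda>F. deriv_coker F x) Fs"

lemma proj_map_in_listset:
  assumes "\<forall>F\<in>set Fs. polynomial_system F"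
  shows "proj_map (cokers Fs x) v \<in> listset (cokers Fs x)"
  using assms orth_proj_perp(1)[OF vec_subspace_deriv_ker]
  by (auto simp: mem_listset_iff proj_map_def list_all2_map1 list_all2_map2 intro!: list.rel_refl_strong)

text \<open>The kernel of each projection is the kernel of that block's derivative, and these
  intersect in the kernel of the concatenated derivative. Hence \<open>pinv_surj\<close> applies to
  \<open>proj_map\<close> with that same kernel.\<close>

lemma proj_map_eq_iff:
  assumes "\<forall>F\<in>set Fs. polynomial_system F"
  shows "proj_map (cokers Fs x) u = proj_map (cokers Fs x) v \<longleftrightarrow> u - v \<in> deriv_ker (concat Fs) x"
proof -
  have "proj_map (cokers Fs x) u = proj_map (cokers Fs x) v \<longleftrightarrow>
      (\<forall>F\<in>set Fs. u - v \<in> deriv_ker F x)"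
    using assms by (auto simp: proj_map_def orth_proj_perp_eq_iff vec_subspace_deriv_ker)
  then show ?thesis by (auto simp: mem_deriv_ker_iff)
qed

lemma system_deriv_concat:
  "system_deriv (concat Fs) x vs = concat (map (\<lambda>F. system_deriv F x vs) Fs)"
  by (simp add: system_deriv_def[abs_def] map_concat)

section \<open>Surjectivity of the concatenated derivative\<close>

lemma deriv_surj_concat_imp_block:
  assumes surj: "deriv_surj (concat Fs) x" and F: "F \<in> set Fs"
  shows "deriv_surj F x"
proof (intro equalityI subsetI)
  fix w :: "complex list" assume w: "w \<in> {w. length w = length F}"
  obtain As Bs where Fs: "Fs = As @ F # Bs"
    using split_list[OF F] by blast
  \<comment> \<open>The target is padded with zeros in all the other blocks.\<close>
  let ?w = "replicate (length (concat As)) 0 @ w @ replicate (length (concat Bs)) 0"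
  have "?w \<in> range (system_deriv1 (concat Fs) x)"
    unfolding surj using w by (simp add: Fs)
  then obtain v where "system_deriv1 (concat Fs) x v = ?w" by auto
  then have "system_deriv1 F x v = w"
    using w by (simp add: Fs system_deriv_def del: iterated_deriv.simps)
  then show "w \<in> range (system_deriv1 F x)" by auto
qed auto

text \<open>Given \<open>us\<close> in the product of complements, surjectivity provides one
  \<open>v\<close> whose image under each block derivative is that of the matching entry of
  \<open>us\<close>. Then \<open>v\<close> differs from each entry by a kernel element, so its
  projections are \<open>us\<close>.\<close>

lemma deriv_surj_concat_imp_proj_map_surj:
  assumes Fs: "\<forall>F\<in>set Fs. polynomial_system F" and surj: "deriv_surj (concat Fs) x"
  shows "range (proj_map (cokers Fs x)) = listset (cokers Fs x)"
proof (intro equalityI subsetI)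
  fix us assume us: "us \<in> listset (cokers Fs x)"
  then have len: "length us = length Fs"
    by (auto simp: mem_listset_iff dest: list_all2_lengthD)
  let ?ws = "map2 (\<lambda>F u. system_deriv1 F x u) Fs us"
  have "map length ?ws = map length Fs"
    using len by (auto simp: list_eq_iff_nth_eq)
  then have "concat ?ws \<in> range (system_deriv1 (concat Fs) x)"
    unfolding surj by (simp add: length_concat)
  then obtain v where "concat (map (\<lambda>F. system_deriv1 F x v) Fs) = concat ?ws"
    by (auto simp: system_deriv_concat)
  \<comment> \<open>Corresponding blocks have equal lengths, so equality of the concatenations
    separates into equality of blocks.\<close>
  then have "map (\<lambda>F. system_deriv1 F x v) Fs = ?ws"
    using len by (intro concat_injective) (auto simp: set_zip)
  then have eq: "system_deriv1 (Fs ! i) x v = system_deriv1 (Fs ! i) x (us ! i)" if "i < length Fs" for i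
    using len that by (auto simp: list_eq_iff_nth_eq)
  have "proj_map (cokers Fs x) v = us"
  proof (rule nth_equalityI)
    fix i assume "i < length (proj_map (cokers Fs x) v)"
    then have i: "i < length Fs" by (simp add: proj_map_def)
    then have F: "polynomial_system (Fs ! i)" using Fs by simp
    have "us ! i \<in> deriv_coker (Fs ! i) x"
      using us i len by (auto simp: mem_listset_iff list_all2_conv_all_nth)
    moreover have "v - us ! i \<in> deriv_ker (Fs ! i) x"
      using eq[OF i] system_deriv1_eq_iff[OF F] by blast
    ultimately show "proj_map (cokers Fs x) v ! i = us ! i"
      using i by (simp add: proj_map_def orth_proj_perp_unique[OF vec_subspace_deriv_ker[OF F]])
  qed (simp add: len proj_map_def)
  then show "us \<in> range (proj_map (cokers Fs x))" by auto
qed (use proj_map_in_listset[OF Fs] in auto)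

lemma length_concat_split:
  assumes "length w = length (concat Fs)"
  obtains ws where "w = concat ws" "list_all2 (\<lambda>w F. length w = length F) ws Fs"
  using assms
proof (induction Fs arbitrary: w thesis)
  case (Cons F Fs)
  obtain ws where "drop (length F) w = concat ws" "list_all2 (\<lambda>w F. length w = length F) ws Fs"
    using Cons.IH[of "drop (length F) w"] Cons.prems(2) by auto
  then show ?case
    using Cons.prems(1)[of "take (length F) w # ws"] Cons.prems(2)
    by (simp flip: \<open>drop (length F) w = concat ws\<close>)
qed simp

text \<open>Each block of the target is lifted to its complement by the block's pseudo-inverse;
  surjectivity of \<open>proj_map\<close> glues the lifts into a single vector.\<close>

lemma deriv_surj_concat:
  assumes Fs: "\<forall>F\<in>set Fs. polynomial_system F" and surj: "\<forall>F\<in>set Fs. deriv_surj F x"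
    and proj: "range (proj_map (cokers Fs x)) = listset (cokers Fs x)"
  shows "deriv_surj (concat Fs) x"
proof (intro equalityI subsetI)
  fix w :: "complex list" assume "w \<in> {w. length w = length (concat Fs)}"
  then obtain ws where w: "w = concat ws" and ws: "list_all2 (\<lambda>w F. length w = length F) ws Fs"
    using length_concat_split by blast
  have len: "length ws = length Fs" using ws by (rule list_all2_lengthD)
  let ?us = "map2 (\<lambda>F w. system_pinv F x w) Fs ws"
  have "?us \<in> listset (cokers Fs x)"
    using Fs surj ws len
    by (auto simp: mem_listset_iff list_all2_conv_all_nth intro!: system_pinv_coker)
  then obtain v where v: "proj_map (cokers Fs x) v = ?us"
    unfolding proj[symmetric] by auto
  have "map (\<lambda>F. system_deriv1 F x v) Fs = ws"
  proof (rule nth_equalityI)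
    fix i assume "i < length (map (\<lambda>F. system_deriv1 F x v) Fs)"
    then have i: "i < length Fs" by simp
    then have F: "polynomial_system (Fs ! i)" "deriv_surj (Fs ! i) x" using Fs surj by auto
    have l: "length (ws ! i) = length (Fs ! i)" using ws i by (simp add: list_all2_conv_all_nth)
    have "orth_proj (deriv_coker (Fs ! i) x) v = system_pinv (Fs ! i) x (ws ! i)"
      using arg_cong[OF v, of "\<lambda>us. us ! i"] i len by (simp add: proj_map_def)
    then have "v - system_pinv (Fs ! i) x (ws ! i) \<in> deriv_ker (Fs ! i) x"
      using orth_proj_perp(2)[OF vec_subspace_deriv_ker[OF F(1)]] by metis
    then have "system_deriv1 (Fs ! i) x v = ws ! i"
      using system_deriv1_eq_iff[OF F(1)] system_pinv_right[OF F l] by metis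
    then show "map (\<lambda>F. system_deriv1 F x v) Fs ! i = ws ! i" using i by simp
  qed (simp add: len)
  then have "system_deriv1 (concat Fs) x v = w"
    by (simp add: system_deriv_concat w)
  then show "w \<in> range (system_deriv1 (concat Fs) x)" by auto
qed auto

section \<open>Estimates for the incidence condition number\<close>

lemma incidence_cond_bound:
  assumes Fs: "\<forall>F\<in>set Fs. polynomial_system F"
    and proj: "range (proj_map (cokers Fs x)) = listset (cokers Fs x)"
  obtains \<kappa> where "incidence_cond Fs x = ereal \<kappa>"
    and "\<And>v. v \<in> deriv_coker (concat Fs) x \<Longrightarrow>
      norm v \<le> \<kappa> * list_norm (map (\<lambda>F. orth_proj (deriv_coker F x) v) Fs)"
proof -
  let ?K = "deriv_ker (concat Fs) x"
  let ?Es = "cokers Fs x"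
  let ?pinv = "pinv (list_cinner cinner) (listset ?Es) (proj_map ?Es)"
  let ?ball = "{ws \<in> listset ?Es. list_norm ws \<le> 1}"
  define \<kappa> where "\<kappa> = (SUP ws\<in>?ball. norm (?pinv ws))"
  have K: "vec.subspace ?K"
    by (intro vec_subspace_deriv_ker polynomial_system_concat Fs)
  note pinv = pinv_surj[OF K proj_map_eq_iff[OF Fs] proj, where ip = "list_cinner cinner"]
  let ?gs = "map (\<lambda>F. orth_proj (deriv_coker F x)) Fs"
  have gs: "map (\<lambda>g. g v) ?gs = proj_map ?Es v" for v
    by (simp add: proj_map_def)
  have lin: "linear g" if "g \<in> set ?gs" for g
    using that Fs linear_orth_proj_perp[OF vec_subspace_deriv_ker] by auto
  have inj: "v = 0" if v: "v \<in> hermitian_perp ?K" "\<forall>g\<in>set ?gs. g v = 0" for v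
  proof -
    have "map (\<lambda>g. g v) ?gs = map (\<lambda>g. g 0) ?gs"
      unfolding map_eq_conv using v(2) lin by (simp add: linear_0)
    then have "v - 0 \<in> ?K"
      unfolding gs proj_map_eq_iff[OF Fs] .
    then show ?thesis using v(1) hermitian_perp_disjoint by fastforce
  qed
  \<comment> \<open>A crude constant from compactness: it shows that the supremum defining
    \<open>\<kappa>\<close> is over a bounded set, and it settles the case where all projections
    vanish.\<close>
  obtain C where C: "0 \<le> C"
    and bound: "\<And>v. v \<in> hermitian_perp ?K \<Longrightarrow> norm v \<le> C * list_norm (proj_map ?Es v)"
    by (rule linear_family_bounded_below[where gs = ?gs,
          OF vec_subspace_imp_subspace[OF vec_subspace_hermitian_perp] lin inj, unfolded gs]) blast+
  have "norm (?pinv ws) \<le> C" if "ws \<in> ?ball" for ws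
    using bound[OF pinv(1)[of ws]] pinv(2)[of ws] that C
    by (smt (verit) mem_Collect_eq mult_left_le)
  then have bdd: "bdd_above ((\<lambda>ws. norm (?pinv ws)) ` ?ball)"
    by (rule bdd_aboveI2)
  \<comment> \<open>On the complement of the kernel \<open>v\<close> is the pseudo-inverse of its
    own tuple of projections, so \<open>norm v\<close> is one of the values under the
    supremum.\<close>
  have unit: "norm v \<le> \<kappa>" if "v \<in> hermitian_perp ?K" "list_norm (proj_map ?Es v) \<le> 1" for v
    using cSUP_upper[OF _ bdd, of "proj_map ?Es v"] pinv(3)[OF that(1)] that(2)
      proj_map_in_listset[OF Fs] by (simp add: \<kappa>_def)
  have "norm v \<le> \<kappa> * list_norm (proj_map ?Es v)" if v: "v \<in> hermitian_perp ?K" for v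
  proof (cases "list_norm (proj_map ?Es v) = 0")
    case True
    then show ?thesis using bound[OF v] by simp
  next
    case False
    let ?t = "list_norm (proj_map ?Es v)"
    have t: "0 < ?t" using False list_norm_nonneg[of "proj_map ?Es v"] by simp
    have "proj_map ?Es ((1 / ?t) *\<^sub>R v) = map ((*\<^sub>R) (1 / ?t)) (proj_map ?Es v)"
      unfolding gs[symmetric] map_map map_eq_conv o_def using linear_scale[OF lin] by simp
    then have "list_norm (proj_map ?Es ((1 / ?t) *\<^sub>R v)) = 1"
      using t by (simp add: list_norm_scaleR)
    moreover have "(1 / ?t) *\<^sub>R v \<in> hermitian_perp ?K"
      by (rule subspace_scale[OF vec_subspace_imp_subspace[OF vec_subspace_hermitian_perp] v])
    ultimately have "norm ((1 / ?t) *\<^sub>R v) \<le> \<kappa>" by (intro unit) auto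
    then show ?thesis using t by (simp add: field_simps)
  qed
  then show ?thesis
    using that[of \<kappa>] proj
    by (simp add: incidence_cond_def subspace_cond_def \<kappa>_def proj_map_def o_def)
qed

text \<open>The tuple with a unit vector \<open>w\<close> in the first place and zeros elsewhere has
  norm 1, and any preimage of it projects to \<open>w\<close>, hence has norm at least 1.
  Nonemptiness of the first block is what provides such a \<open>w\<close>.\<close>

lemma incidence_cond_ge_1:
  assumes Fs: "\<forall>F\<in>set Fs. polynomial_system F"
    and proj: "range (proj_map (cokers Fs x)) = listset (cokers Fs x)"
    and ne: "Fs \<noteq> []" "hd Fs \<noteq> []" and surj: "deriv_surj (hd Fs) x"
  shows "1 \<le> incidence_cond Fs x"
proof -
  obtain \<kappa> where \<kappa>: "incidence_cond Fs x = ereal \<kappa>"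
    and bound: "\<And>v. v \<in> deriv_coker (concat Fs) x \<Longrightarrow>
      norm v \<le> \<kappa> * list_norm (map (\<lambda>F. orth_proj (deriv_coker F x) v) Fs)"
    using incidence_cond_bound[OF Fs proj] by blast
  obtain F Fs' where Fs_eq: "Fs = F # Fs'" using ne by (cases Fs) auto
  have F: "polynomial_system F" "deriv_surj F x" "F \<noteq> []"
    using Fs surj ne by (auto simp: Fs_eq)
  \<comment> \<open>Any nonzero target would do; the all-ones list shows that the first complement
    is not trivial.\<close>
  define u where "u = system_pinv F x (replicate (length F) 1)"
  have u: "u \<in> deriv_coker F x" "system_deriv1 F x u = replicate (length F) 1"
    using system_pinv_surj(1,2)[OF F(1,2), of "replicate (length F) 1"] by (simp_all add: u_def)
  have "u \<noteq> 0"
  proof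
    assume "u = 0"
    then have "u \<in> deriv_ker F x"
      using vec.subspace_0[OF vec_subspace_deriv_ker[OF F(1)]] by simp
    then show False
      using u(2) F(3) by (cases F) (auto simp: deriv_ker_def)
  qed
  define w where "w = (1 / norm u) *\<^sub>R u"
  have w: "w \<in> deriv_coker F x" "norm w = 1"
    using u \<open>u \<noteq> 0\<close> subspace_scale[OF vec_subspace_imp_subspace[OF vec_subspace_hermitian_perp]]
    by (auto simp: w_def)
  let ?ws = "w # map (\<lambda>_. 0) Fs'"
  have "list_all2 (\<in>) (map (\<lambda>_. 0) Hs) (cokers Hs x)" for Hs :: "'a poly_system list"
    by (induction Hs) (auto simp: hermitian_perp_def)
  then have "?ws \<in> listset (cokers Fs x)"
    unfolding mem_listset_iff Fs_eq using w by simp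
  then obtain v0 where v0: "proj_map (cokers Fs x) v0 = ?ws"
    unfolding proj[symmetric] by auto
  have K: "vec.subspace (deriv_ker (concat Fs) x)"
    by (intro vec_subspace_deriv_ker polynomial_system_concat Fs)
  \<comment> \<open>Removing the component in the common kernel leaves all projections unchanged and
    makes \<open>bound\<close> applicable.\<close>
  obtain v where v: "v \<in> deriv_coker (concat Fs) x" "v0 - v \<in> deriv_ker (concat Fs) x"
    using hermitian_decomp[OF K] by blast
  have pv: "map (\<lambda>F. orth_proj (deriv_coker F x) v) Fs = ?ws"
    using v0 proj_map_eq_iff[OF Fs, of x v0 v] v(2) by (simp add: proj_map_def o_def)
  have "(\<Sum>w\<leftarrow>map (\<lambda>_. 0::complex ^ 'a) Hs. (norm w)\<^sup>2) = 0" for Hs :: "'a poly_system list"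
    by (induction Hs) auto
  then have "list_norm ?ws = 1"
    using w(2) by (simp add: list_norm_def)
  then have "norm v \<le> \<kappa>" using bound[OF v(1)] by (simp add: pv)
  moreover have "norm w \<le> norm v"
    using norm_orth_proj_perp_le[OF vec_subspace_deriv_ker[OF F(1)], of x v] pv
    by (simp add: Fs_eq)
  ultimately show ?thesis using w(2) by (simp add: \<kappa>)
qed

section \<open>Comparison of the gamma numbers of the blocks and of the whole system\<close>

lemma gamma_term_concat:
  assumes Fs: "\<forall>F\<in>set Fs. polynomial_system F" and surj: "deriv_surj (concat Fs) x"
  shows gamma_term_concat_coker: "gamma_term (concat Fs) x k vs \<in> deriv_coker (concat Fs) x"
    and orth_proj_gamma_term_concat: "F \<in> set Fs \<Longrightarrow>
      orth_proj (deriv_coker F x) (gamma_term (concat Fs) x k vs) = gamma_term F x k vs"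
proof -
  let ?G = "concat Fs"
  let ?v = "system_pinv ?G x (system_deriv ?G x vs)"
  note G = polynomial_system_concat[OF Fs]
  show "gamma_term ?G x k vs \<in> deriv_coker ?G x"
    unfolding gamma_term_def
    by (intro subspace_scale vec_subspace_imp_subspace vec_subspace_hermitian_perp
        system_pinv_coker[OF G surj]) simp
  assume F: "F \<in> set Fs"
  then have pF: "polynomial_system F" using Fs by auto
  have "system_deriv1 ?G x ?v = system_deriv ?G x vs"
    by (rule system_pinv_right[OF G surj]) simp
  \<comment> \<open>The rows of \<open>F\<close> are among those of the concatenation, so the
    equation restricts to them.\<close>
  then have "system_deriv1 F x ?v = system_deriv F x vs"
    unfolding system_deriv_def map_eq_conv using F by auto
  then have "orth_proj (deriv_coker F x) ?v = system_pinv F x (system_deriv F x vs)"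
    using orth_proj_eq_system_pinv[OF pF deriv_surj_concat_imp_block[OF surj F]] by simp
  then show "orth_proj (deriv_coker F x) (gamma_term ?G x k vs) = gamma_term F x k vs"
    unfolding gamma_term_def
    by (simp add: linear_scale[OF linear_orth_proj_perp[OF vec_subspace_deriv_ker[OF pF]]])
qed

text \<open>Each term of a block is the orthogonal projection of the corresponding term of the whole
  system, and projections do not increase norms.\<close>

lemma gamma_number_block_le:
  assumes Fs: "\<forall>F\<in>set Fs. polynomial_system F" and surj: "deriv_surj (concat Fs) x"
    and F: "F \<in> set Fs"
  shows "gamma_number F x \<le> gamma_number (concat Fs) x"
proof -
  have pF: "polynomial_system F" using Fs F by auto
  note pG = polynomial_system_concat[OF Fs]
  note sF = deriv_surj_concat_imp_block[OF surj F]
  have "multilinear_norm k (gamma_term F x k) \<le> multilinear_norm k (gamma_term (concat Fs) x k)" for k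
    unfolding multilinear_norm_def
  proof (rule cSUP_mono[OF _ bdd_above_gamma_term[OF pG surj]])
    show "unit_lists k \<noteq> ({} :: (complex ^ 'a) list set)"
      using replicate_zero_unit_lists by blast
    show "\<exists>ws\<in>unit_lists k. norm (gamma_term F x k vs) \<le> norm (gamma_term (concat Fs) x k ws)"
      if "vs \<in> unit_lists k" for vs
      using norm_orth_proj_perp_le[OF vec_subspace_deriv_ker[OF pF], of x "gamma_term (concat Fs) x k vs"]
      by (intro bexI[OF _ that]) (simp only: orth_proj_gamma_term_concat[OF Fs surj F])
  qed
  then show ?thesis
    unfolding gamma_number_eq_SUP[OF sF] gamma_number_eq_SUP[OF surj]
    by (intro SUP_mono) (auto intro!: bexI real_root_le_mono)
qed

text \<open>Superadditivity of the \<open>m\<close>th power on nonnegative reals: split off one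
  factor and enlarge the remaining \<open>m - 1\<close> from \<open>a\<close> or \<open>b\<close> to
  \<open>a + b\<close>. For \<open>m = 0\<close> the left side would count the entries.\<close>

lemma sum_list_power_le_power_sum_list:
  fixes f :: "'a \<Rightarrow> real"
  assumes "\<And>a. a \<in> set xs \<Longrightarrow> 0 \<le> f a" and "1 \<le> m"
  shows "(\<Sum>a\<leftarrow>xs. f a ^ m) \<le> (\<Sum>a\<leftarrow>xs. f a) ^ m"
proof -
  have sum_ge: "a ^ m + b ^ m \<le> (a + b) ^ m" if ab: "0 \<le> a" "0 \<le> b" for a b :: real
  proof -
    obtain l where m: "m = Suc l" using assms(2) by (cases m) auto
    have "a * a ^ l + b * b ^ l \<le> a * (a + b) ^ l + b * (a + b) ^ l"
      using ab by (intro add_mono mult_left_mono power_mono) auto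
    then show ?thesis by (simp add: m algebra_simps)
  qed
  show ?thesis
    using assms(1)
  proof (induction xs)
    case (Cons a xs)
    have "f a ^ m + (\<Sum>a\<leftarrow>xs. f a ^ m) \<le> f a ^ m + (\<Sum>a\<leftarrow>xs. f a) ^ m"
      using Cons by simp
    also have "\<dots> \<le> (f a + (\<Sum>a\<leftarrow>xs. f a)) ^ m"
      using Cons.prems by (intro sum_ge sum_list_nonneg) auto
    finally show ?case by simp
  qed (use assms(2) in simp)
qed

lemma gamma_number_concat_le:
  assumes Fs: "\<forall>F\<in>set Fs. polynomial_system F" and surj: "deriv_surj (concat Fs) x"
    and g: "\<And>F. F \<in> set Fs \<Longrightarrow> gamma_number F x = ereal (g F)"
    and \<kappa>: "1 \<le> \<kappa>" and bound: "\<And>v. v \<in> deriv_coker (concat Fs) x \<Longrightarrow>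
      norm v \<le> \<kappa> * list_norm (map (\<lambda>F. orth_proj (deriv_coker F x) v) Fs)"
  shows "gamma_number (concat Fs) x \<le> ereal (\<kappa> * sqrt (\<Sum>F\<leftarrow>Fs. (g F)\<^sup>2))"
  unfolding gamma_number_eq_SUP[OF surj]
proof (rule SUP_least)
  fix k :: nat assume "k \<in> {2..}"
  then have k: "2 \<le> k" by simp
  let ?s = "\<Sum>F\<leftarrow>Fs. (g F)\<^sup>2"
  let ?N = "multilinear_norm k (gamma_term (concat Fs) x k)"
  have s: "0 \<le> ?s" by (auto intro!: sum_list_nonneg)
  have "?N \<le> (\<kappa> * sqrt ?s) ^ (k - 1)"
    unfolding multilinear_norm_def
  proof (rule cSUP_least)
    show "unit_lists k \<noteq> ({} :: (complex ^ 'a) list set)"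
      using replicate_zero_unit_lists by blast
    fix vs :: "(complex ^ 'a) list" assume vs: "vs \<in> unit_lists k"
    let ?b = "gamma_term (concat Fs) x k vs"
    have "list_norm (map (\<lambda>F. orth_proj (deriv_coker F x) ?b) Fs) \<le>
        sqrt (\<Sum>F\<leftarrow>Fs. (g F ^ (k - 1))\<^sup>2)"
    proof (rule list_norm_mono)
      fix F assume F: "F \<in> set Fs"
      then have pF: "polynomial_system F" using Fs by auto
      note sF = deriv_surj_concat_imp_block[OF surj F]
      show "norm (orth_proj (deriv_coker F x) ?b) \<le> g F ^ (k - 1)"
        using norm_gamma_term_le[OF pF sF vs] multilinear_norm_le_gamma_power[OF pF sF g[OF F] k]
        by (simp add: orth_proj_gamma_term_concat[OF Fs surj F])
    qed
    also have "(\<Sum>F\<leftarrow>Fs. (g F ^ (k - 1))\<^sup>2) = (\<Sum>F\<leftarrow>Fs. ((g F)\<^sup>2) ^ (k - 1))"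
      by (simp add: mult.commute flip: power_mult)
    \<comment> \<open>Superadditivity for the squares of the block gamma numbers; the exponent
      \<open>k - 1\<close> is at least 1.\<close>
    also have "sqrt \<dots> \<le> sqrt (?s ^ (k - 1))"
      using k by (intro real_sqrt_le_mono sum_list_power_le_power_sum_list) auto
    also have "sqrt (?s ^ (k - 1)) = sqrt ?s ^ (k - 1)"
      by (rule real_sqrt_power)
    finally have l: "list_norm (map (\<lambda>F. orth_proj (deriv_coker F x) ?b) Fs) \<le> sqrt ?s ^ (k - 1)" .
    have "norm ?b \<le> \<kappa> * list_norm (map (\<lambda>F. orth_proj (deriv_coker F x) ?b) Fs)"
      by (rule bound[OF gamma_term_concat_coker[OF Fs surj]])
    \<comment> \<open>Here \<open>1 \<le> \<kappa>\<close> enters: replacing \<open>\<kappa>\<close>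
      by its power allows the \<open>(k - 1)\<close>th root to be taken of the whole
      product.\<close>
    also have "\<dots> \<le> \<kappa> ^ (k - 1) * sqrt ?s ^ (k - 1)"
      using self_le_power[OF \<kappa>, of "k - 1"] k \<kappa> by (intro mult_mono l list_norm_nonneg) auto
    finally show "norm ?b \<le> (\<kappa> * sqrt ?s) ^ (k - 1)"
      by (simp only: power_mult_distrib)
  qed
  then have "root (k - 1) ?N \<le> root (k - 1) ((\<kappa> * sqrt ?s) ^ (k - 1))"
    using k by (intro real_root_le_mono) auto
  also have "\<dots> = \<kappa> * sqrt ?s"
    using k \<kappa> s by (intro real_root_power_cancel) auto
  finally show "ereal (root (k - 1) ?N) \<le> ereal (\<kappa> * sqrt ?s)" by simp
qed

theorem theorem13:
  fixes n r :: nat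
    and Ds :: "nat list list"
    and Fs :: "'n::finite poly_system list"
    and G :: "'n poly_system"
    and x :: "complex ^ 'n"
  assumes "CARD('n) = n + 1"
    and "1 \<le> r" and "length Ds = r" and "length Fs = r"
    and "\<forall>i<r. Fs ! i \<in> hom_systems (Ds ! i)"
    and "(\<Sum>i<r. length (Fs ! i)) \<le> n"
    and "G = concat Fs"
    and "norm x = 1"
  shows "gamma_number G x \<le> split_gamma Fs x \<and>
         split_gamma Fs x \<le> ereal (real r) *\<^sub>\<infinity> incidence_cond Fs x *\<^sub>\<infinity> gamma_number G x"
proof -
  have hom: "F \<noteq> [] \<and> polynomial_system F" if F: "F \<in> set Fs" for F
  proof -
    obtain i where i: "i < r" "F = Fs ! i"
      using F assms(4) by (auto simp: in_set_conv_nth)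
    then have "Ds ! i \<noteq> []" "list_all2 homogeneous_poly (Ds ! i) F"
      using assms(5) by (auto simp: hom_systems_def)
    moreover from this(2) have "list_all2 (\<lambda>_. polynomial_map) (Ds ! i) F"
      by (rule list_all2_mono) (rule homogeneous_poly_imp_polynomial_map)
    ultimately show ?thesis
      by (auto simp: polynomial_system_def list_all2_conv_all_nth in_set_conv_nth)
  qed
  then have Fs: "\<forall>F\<in>set Fs. polynomial_system F" by blast
  have ne: "Fs \<noteq> []" using assms(2,4) by auto
  show ?thesis
  proof (cases "deriv_surj G x")
    case False
    then have "gamma_number G x = \<infinity>" by (simp add: gamma_number_def)
    \<comment> \<open>If the concatenated derivative is not surjective, some block derivative or the
      projection map is not either, so one factor of the split gamma number is infinite.\<close>
    moreover have "split_gamma Fs x = \<infinity>"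
    proof (cases "\<forall>F\<in>set Fs. deriv_surj F x")
      case True
      then have "range (proj_map (cokers Fs x)) \<noteq> listset (cokers Fs x)"
        using deriv_surj_concat[OF Fs] False assms(7) by blast
      then show ?thesis
        by (simp add: split_gamma_def inf_times_def incidence_cond_def subspace_cond_def)
    next
      case False
      then obtain F where "F \<in> set Fs" "\<not> deriv_surj F x" by blast
      moreover from this(2) have "gamma_number F x = \<infinity>" by (simp add: gamma_number_def)
      ultimately have "\<infinity> \<in> set (map (\<lambda>F. gamma_number F x) Fs)" by force
      then show ?thesis by (simp add: split_gamma_def inf_times_def ereal_l2_def)
    qed
    ultimately show ?thesis by (simp add: inf_times_def)
  next
    case True
    then have surj: "deriv_surj (concat Fs) x" using assms(7) by simp
    note block_surj = deriv_surj_concat_imp_block[OF surj]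
    note proj = deriv_surj_concat_imp_proj_map_surj[OF Fs surj]
    obtain \<kappa> where \<kappa>: "incidence_cond Fs x = ereal \<kappa>"
      and bound: "\<And>v. v \<in> deriv_coker (concat Fs) x \<Longrightarrow>
        norm v \<le> \<kappa> * list_norm (map (\<lambda>F. orth_proj (deriv_coker F x) v) Fs)"
      using incidence_cond_bound[OF Fs proj] by blast
    have \<kappa>1: "1 \<le> \<kappa>"
      using incidence_cond_ge_1[OF Fs proj ne] hom[OF hd_in_set[OF ne]]
        block_surj[OF hd_in_set[OF ne]] by (simp add: \<kappa>)
    let ?\<gamma> = "\<lambda>F. gamma_number F x"
    let ?g = "\<lambda>F. real_of_ereal (?\<gamma> F)"
    have nonneg: "0 \<le> ?\<gamma> F" if "F \<in> set Fs" for F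
      using gamma_number_nonneg[OF _ block_surj[OF that]] Fs that by blast
    \<comment> \<open>\<open>real_of_ereal\<close> sends \<open>\<infinity>\<close> to 0, so the
      real formula is restricted to finite block gamma numbers.\<close>
    have split: "split_gamma Fs x = ereal (\<kappa> * sqrt (\<Sum>F\<leftarrow>Fs. (?g F)\<^sup>2))"
      if "\<infinity> \<notin> ?\<gamma> ` set Fs"
      using that by (simp add: split_gamma_def inf_times_def ereal_l2_def \<kappa> o_def)
    have fin: "?\<gamma> F = ereal (?g F)" if "\<infinity> \<notin> ?\<gamma> ` set Fs" "F \<in> set Fs" for F
      using nonneg[OF that(2)] that by (cases "?\<gamma> F") (auto simp: image_iff)
    have "?\<gamma> G \<le> split_gamma Fs x"
    proof (cases "\<infinity> \<in> ?\<gamma> ` set Fs")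
      case True
      then show ?thesis by (simp add: split_gamma_def inf_times_def ereal_l2_def)
    next
      case False
      then show ?thesis
        unfolding split[OF False] assms(7)
        by (intro gamma_number_concat_le[OF Fs surj _ \<kappa>1 bound] fin) auto
    qed
    moreover have "split_gamma Fs x \<le> ereal (real r) *\<^sub>\<infinity> incidence_cond Fs x *\<^sub>\<infinity> ?\<gamma> G"
    proof (cases "?\<gamma> G = \<infinity>")
      case True
      then show ?thesis by (simp add: inf_times_def)
    next
      case False
      have le: "?\<gamma> F \<le> ?\<gamma> G" if "F \<in> set Fs" for F
        using gamma_number_block_le[OF Fs surj that] assms(7) by simp
      have notinf: "\<infinity> \<notin> ?\<gamma> ` set Fs" using le False by force
      obtain c where c: "?\<gamma> G = ereal c" and c0: "0 \<le> c"
        using False le[OF hd_in_set[OF ne]] nonneg[OF hd_in_set[OF ne]]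
        by (cases "?\<gamma> G") (auto dest: order_trans)
      have "0 \<le> ?g F \<and> ?g F \<le> c" if "F \<in> set Fs" for F
        using fin[OF notinf that] le[OF that] nonneg[OF that] c by (metis ereal_less_eq(3,5))
      then have "(\<Sum>F\<leftarrow>Fs. (?g F)\<^sup>2) \<le> (\<Sum>F\<leftarrow>Fs. c\<^sup>2)"
        by (intro sum_list_mono power_mono) auto
      also have "\<dots> = real r * c\<^sup>2"
        using assms(4) by (simp add: sum_list_triv)
      \<comment> \<open>The estimate so far would give the factor \<open>sqrt r\<close>; it is
        relaxed to \<open>r\<close>, using \<open>1 \<le> r\<close>.\<close>
      also have "\<dots> \<le> (real r)\<^sup>2 * c\<^sup>2"
        using assms(2) by (intro mult_right_mono self_le_power) auto
      finally have "sqrt (\<Sum>F\<leftarrow>Fs. (?g F)\<^sup>2) \<le> real r * c"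
        using c0 by (intro real_le_lsqrt) (auto simp: power_mult_distrib)
      then have "\<kappa> * sqrt (\<Sum>F\<leftarrow>Fs. (?g F)\<^sup>2) \<le> real r * \<kappa> * c"
        using \<kappa>1 mult_left_mono[of _ "real r * c" \<kappa>] by (simp add: mult_ac)
      then show ?thesis
        unfolding split[OF notinf] by (simp add: inf_times_def \<kappa> c)
    qed
    ultimately show ?thesis by blast
  qed
qed

end
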